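(* The order-preserving logic of perfect paradefinite algebras (in its Set-Set form $\mathcal{PP}_{\leq}^{\rhd}$) is a $\mathbf C$-system and a $\mathbf D$-system, with consistency connective $\circ$ and determinedness connective ${\sim}\circ$; in particular it is both a Logic of Formal Inconsistency and a Logic of Formal Undeterminedness.
   Context: Formulas are over $\{\land,\lor,\sim,\circ,\top,\bot\}$ and a denumerable set of variables. A De Morgan algebra is a bounded distributive lattice with a unary operation $\sim$ satisfying ${\sim}{\sim}x\approx x$ and ${\sim}(x\land y)\approx{\sim}x\lor{\sim}y$. A perfect paradefinite algebra (PP-algebra) is a De Morgan algebra with a unary operation $\circ$ satisfying $\circ\circ x\approx\top$; $\circ x\approx\circ{\sim}x$; $\circ\top\approx\top$; $x\land{\sim}x\land\circ x\approx\bot$; $\circ(x\land y)\approx(\circ x\lor\circ y)\land(\circ x\lor{\sim}y)\land(\circ y\lor{\sim}x)$. The Set-Set logic $\mathcal{PP}_{\leq}^{\rhd}$: $\Phi\rhd\Psi$ iff there are finite $\Phi'\subseteq\Phi$, $\Psi'\subseteq\Psi$ such that $\bigwedge\Phi'\approx\bigwedge\Phi'\land\bigvee\Psi'$ is valid in all PP-algebras ($\bigwedge\varnothing=\top$, $\bigvee\varnothing=\bot$). Let $\rhd$ be a Set-Set logic (generalized consequence relation) with a unary $\sim$, let $\blacktriangleright$ be its complement, and let $p,q$ be distinct variables. It is $\sim$-paraconsistent if $p,{\sim}p\blacktriangleright q$ and $\sim$-paracomplete if $q\blacktriangleright p,{\sim}p$. It is $\sim$-gently explosive if there is a set $\bigcirc(p)$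 of formulas in the single variable $p$ such that for some formula $\varphi$: $\bigcirc(\varphi),\varphi\blacktriangleright\varnothing$ and $\bigcirc(\varphi),{\sim}\varphi\blacktriangleright\varnothing$, while for all $\psi$: $\bigcirc(\psi),\psi,{\sim}\psi\rhd\varnothing$. Dually, it is $\sim$-gently implosive if there is a set $\bigstar(p)$ of formulas in the single variable $p$ such that for some $\varphi$: $\varnothing\blacktriangleright\varphi,\bigstar(\varphi)$ and $\varnothing\blacktriangleright{\sim}\varphi,\bigstar(\varphi)$, while for all $\psi$: $\varnothing\rhd{\sim}\psi,\psi,\bigstar(\psi)$. A Logic of Formal Inconsistency (LFI) is a $\sim$-paraconsistent, $\sim$-gently explosive logic; a Logic of Formal Undeterminedness (LFU) is a $\sim$-paracomplete, $\sim$-gently implosive logic. A logic $\rhd_1$ is a $\mathbf C$-system based on a logic $\rhd_2$ (simply a $\mathbf C$-system if such a $\rhd_2$ exists) if it is an LFI, agrees with $\rhd_2$ on statements $\Phi\rhd\Psi$ involving only formulas without $\sim$, and $\bigcirc(p)$ can be taken to be a singleton consisting of a (possibly composite) unary consistency connective applied to $p$. $\mathbf D$-systems and determinedness connectives are defined dually, with LFU and $\bigstar(p)$. Here $\bigcirc(p)=\{\circ p\}$ and $\bigstar(p)=\{{\sim}\circ p\}$. *)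

theory Defs
  imports "HOL-Library.Countable_Set" "HOL-Library.Infinite_Typeclass"
begin

section \<open>Formulas\<close>

datatype fm =
    Var nat
  | Top
  | Bot
  | Neg fm
  | Circ fm
  | Conj fm fm
  | Disj fm fm

instance fm :: countable
  by countable_datatype

primrec vars :: "fm \<Rightarrow> nat set" where
  "vars (Var n) = {n}"
| "vars Top = {}"
| "vars Bot = {}"
| "vars (Neg \<phi>) = vars \<phi>"
| "vars (Circ \<phi>) = vars \<phi>"
| "vars (Conj \<phi> \<psi>) = vars \<phi> \<union> vars \<psi>"
| "vars (Disj \<phi> \<psi>) = vars \<phi> \<union> vars \<psi>"

primrec subst :: "(nat \<Rightarrow> fm) \<Rightarrow> fm \<Rightarrow> fm" where
  "subst \<sigma> (Var n) = \<sigma> n"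
| "subst \<sigma> Top = Top"
| "subst \<sigma> Bot = Bot"
| "subst \<sigma> (Neg \<phi>) = Neg (subst \<sigma> \<phi>)"
| "subst \<sigma> (Circ \<phi>) = Circ (subst \<sigma> \<phi>)"
| "subst \<sigma> (Conj \<phi> \<psi>) = Conj (subst \<sigma> \<phi>) (subst \<sigma> \<psi>)"
| "subst \<sigma> (Disj \<phi> \<psi>) = Disj (subst \<sigma> \<phi>) (subst \<sigma> \<psi>)"

primrec neg_free :: "fm \<Rightarrow> bool" where
  "neg_free (Var n) = True"
| "neg_free Top = True"
| "neg_free Bot = True"
| "neg_free (Neg \<phi>) = False"
| "neg_free (Circ \<phi>) = neg_free \<phi>"
| "neg_free (Conj \<phi> \<psi>) = (neg_free \<phi> \<and> neg_free \<psi>)"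
| "neg_free (Disj \<phi> \<psi>) = (neg_free \<phi> \<and> neg_free \<psi>)"

definition big_conj :: "fm list \<Rightarrow> fm" where
  "big_conj \<phi>s = foldr Conj \<phi>s Top"

definition big_disj :: "fm list \<Rightarrow> fm" where
  "big_disj \<phi>s = foldr Disj \<phi>s Bot"


section \<open>Perfect paradefinite algebras\<close>

record 'a pp_struct =
  carrier :: "'a set"
  meet :: "'a \<Rightarrow> 'a \<Rightarrow> 'a" (infixl \<open>\<sqinter>\<index>\<close> 70)
  join :: "'a \<Rightarrow> 'a \<Rightarrow> 'a" (infixl \<open>\<squnion>\<index>\<close> 65)
  dneg :: "'a \<Rightarrow> 'a" (\<open>\<sim>\<index> _\<close> [81] 80)
  perf :: "'a \<Rightarrow> 'a" (\<open>\<odot>\<index> _\<close> [81] 80)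
  one :: 'a (\<open>\<top>\<index>\<close>)
  zero :: 'a (\<open>\<bottom>\<index>\<close>)

locale bounded_distributive_lattice =
  fixes A :: "'a pp_struct" (structure)
  assumes meet_closed: "\<lbrakk>x \<in> carrier A; y \<in> carrier A\<rbrakk> \<Longrightarrow> x \<sqinter> y \<in> carrier A"
    and join_closed: "\<lbrakk>x \<in> carrier A; y \<in> carrier A\<rbrakk> \<Longrightarrow> x \<squnion> y \<in> carrier A"
    and one_closed: "\<top> \<in> carrier A"
    and zero_closed: "\<bottom> \<in> carrier A"
    and meet_assoc: "\<lbrakk>x \<in> carrier A; y \<in> carrier A; z \<in> carrier A\<rbrakk> \<Longrightarrow>
          (x \<sqinter> y) \<sqinter> z = x \<sqinter> (y \<sqinter> z)"
    and join_assoc: "\<lbrakk>x \<in> carrier A; y \<in> carrier A; z \<in> carrier A\<rbrakk> \<Longrightarrow>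
          (x \<squnion> y) \<squnion> z = x \<squnion> (y \<squnion> z)"
    and meet_comm: "\<lbrakk>x \<in> carrier A; y \<in> carrier A\<rbrakk> \<Longrightarrow> x \<sqinter> y = y \<sqinter> x"
    and join_comm: "\<lbrakk>x \<in> carrier A; y \<in> carrier A\<rbrakk> \<Longrightarrow> x \<squnion> y = y \<squnion> x"
    and meet_absorb: "\<lbrakk>x \<in> carrier A; y \<in> carrier A\<rbrakk> \<Longrightarrow> x \<sqinter> (x \<squnion> y) = x"
    and join_absorb: "\<lbrakk>x \<in> carrier A; y \<in> carrier A\<rbrakk> \<Longrightarrow> x \<squnion> (x \<sqinter> y) = x"
    and distrib: "\<lbrakk>x \<in> carrier A; y \<in> carrier A; z \<in> carrier A\<rbrakk> \<Longrightarrow>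
          x \<sqinter> (y \<squnion> z) = (x \<sqinter> y) \<squnion> (x \<sqinter> z)"
    and meet_one: "x \<in> carrier A \<Longrightarrow> x \<sqinter> \<top> = x"
    and join_zero: "x \<in> carrier A \<Longrightarrow> x \<squnion> \<bottom> = x"

locale de_morgan_algebra = bounded_distributive_lattice +
  assumes dneg_closed: "x \<in> carrier A \<Longrightarrow> \<sim> x \<in> carrier A"
    and dneg_dneg: "x \<in> carrier A \<Longrightarrow> \<sim> (\<sim> x) = x"
    and dneg_meet: "\<lbrakk>x \<in> carrier A; y \<in> carrier A\<rbrakk> \<Longrightarrow> \<sim> (x \<sqinter> y) = \<sim> x \<squnion> \<sim> y"

locale PP_algebra = de_morgan_algebra +
  assumes perf_closed: "x \<in> carrier A \<Longrightarrow> \<odot> x \<in> carrier A"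
    and perf_perf: "x \<in> carrier A \<Longrightarrow> \<odot> (\<odot> x) = \<top>"
    and perf_dneg: "x \<in> carrier A \<Longrightarrow> \<odot> x = \<odot> (\<sim> x)"
    and perf_one: "\<odot> \<top> = \<top>"
    and perf_explosion: "x \<in> carrier A \<Longrightarrow> x \<sqinter> \<sim> x \<sqinter> \<odot> x = \<bottom>"
    and perf_meet: "\<lbrakk>x \<in> carrier A; y \<in> carrier A\<rbrakk> \<Longrightarrow>
          \<odot> (x \<sqinter> y) = (\<odot> x \<squnion> \<odot> y) \<sqinter> (\<odot> x \<squnion> \<sim> y) \<sqinter> (\<odot> y \<squnion> \<sim> x)"

primrec eval :: "'a pp_struct \<Rightarrow> (nat \<Rightarrow> 'a) \<Rightarrow> fm \<Rightarrow> 'a" where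
  "eval A v (Var n) = v n"
| "eval A v Top = one A"
| "eval A v Bot = zero A"
| "eval A v (Neg \<phi>) = dneg A (eval A v \<phi>)"
| "eval A v (Circ \<phi>) = perf A (eval A v \<phi>)"
| "eval A v (Conj \<phi> \<psi>) = meet A (eval A v \<phi>) (eval A v \<psi>)"
| "eval A v (Disj \<phi> \<psi>) = join A (eval A v \<phi>) (eval A v \<psi>)"

text \<open>
  HOL cannot quantify over the algebras on all types inside one formula, so validity takes as a
  parameter the type that the carriers are subsets of. For infinite types the parameter is
  immaterial: by \<open>pp_valid_universal\<close> below, an equation that is valid with respect to one
  infinite type holds in every PP-algebra on every type.
\<close>

definition pp_valid :: "'a itself \<Rightarrow> fm \<Rightarrow> fm \<Rightarrow> bool" where
  "pp_valid (_ :: 'a itself) s t \<longleftrightarrow>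
     (\<forall>(A :: 'a pp_struct) v. PP_algebra A \<longrightarrow> range v \<subseteq> carrier A \<longrightarrow> eval A v s = eval A v t)"

lemma (in PP_algebra) eval_closed:
  "range v \<subseteq> carrier A \<Longrightarrow> eval A v \<phi> \<in> carrier A"
  by (induction \<phi>)
    (auto intro: meet_closed join_closed one_closed zero_closed dneg_closed perf_closed)

theorem pp_valid_universal:
  fixes B :: "'b pp_struct"
  assumes valid: "pp_valid TYPE('a::infinite) s t"
    and B: "PP_algebra B" and v: "range v \<subseteq> carrier B"
  shows "eval B v s = eval B v t"
proof -
  interpret B: PP_algebra B by (rule B)
  define C where "C = range (eval B v)"
  have CB: "x \<in> carrier B" if "x \<in> C" for x
    using that B.eval_closed[OF v] by (auto simp: C_def)
  have "countable C" by (simp add: C_def)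
  obtain h :: "nat \<Rightarrow> 'a" where h: "inj h"
    using infinite_countable_subset[OF infinite_UNIV] by blast
  define f where "f = h \<circ> to_nat_on C"
  have f: "inj_on f C"
    unfolding f_def using h \<open>countable C\<close> by (intro comp_inj_on) (auto intro: inj_on_subset)
  define g where "g = inv_into C f"
  have gf: "g (f x) = x" if "x \<in> C" for x
    using f that by (simp add: g_def)
  have C_meet: "meet B x y \<in> C" and C_join: "join B x y \<in> C" if xy: "x \<in> C" "y \<in> C" for x y
  proof -
    obtain \<phi> \<psi> where "x = eval B v \<phi>" "y = eval B v \<psi>" using xy by (auto simp: C_def)
    then have "meet B x y = eval B v (Conj \<phi> \<psi>)" "join B x y = eval B v (Disj \<phi> \<psi>)" by auto
    then show "meet B x y \<in> C" "join B x y \<in> C" unfolding C_def by blast+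
  qed
  have C_dneg: "dneg B x \<in> C" and C_perf: "perf B x \<in> C" if x: "x \<in> C" for x
  proof -
    obtain \<phi> where "x = eval B v \<phi>" using x by (auto simp: C_def)
    then have "dneg B x = eval B v (Neg \<phi>)" "perf B x = eval B v (Circ \<phi>)" by auto
    then show "dneg B x \<in> C" "perf B x \<in> C" unfolding C_def by blast+
  qed
  have C_one: "one B \<in> C" unfolding C_def by (metis eval.simps(2) rangeI)
  have C_zero: "zero B \<in> C" unfolding C_def by (metis eval.simps(3) rangeI)
  note C = C_meet C_join C_dneg C_perf C_one C_zero
  define A where "A = \<lparr>carrier = f ` C, meet = (\<lambda>x y. f (meet B (g x) (g y))),
    join = (\<lambda>x y. f (join B (g x) (g y))), dneg = (\<lambda>x. f (dneg B (g x))),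
    perf = (\<lambda>x. f (perf B (g x))), one = f (one B), zero = f (zero B)\<rparr>"
  have "PP_algebra A"
  proof
    fix x y z assume x: "x \<in> carrier A" and y: "y \<in> carrier A" and z: "z \<in> carrier A"
    then obtain a b c where abc: "a \<in> C" "b \<in> C" "c \<in> C" and xyz: "x = f a" "y = f b" "z = f c"
      by (auto simp: A_def)
    note abc' = abc[THEN CB]
    note s = A_def xyz gf abc C
    show "meet A (meet A x y) z = meet A x (meet A y z)"
      by (simp add: s B.meet_assoc abc')
    show "join A (join A x y) z = join A x (join A y z)"
      by (simp add: s B.join_assoc abc')
    show "meet A x (join A y z) = join A (meet A x y) (meet A x z)"
      by (simp add: s B.distrib abc')
  next
    fix x y assume x: "x \<in> carrier A" and y: "y \<in> carrier A"
    then obtain a b where ab: "a \<in> C" "b \<in> C" and xy: "x = f a" "y = f b"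
      by (auto simp: A_def)
    note ab' = ab[THEN CB]
    note s = A_def xy gf ab C
    show "meet A x y \<in> carrier A" "join A x y \<in> carrier A" by (simp_all add: s)
    show "meet A x y = meet A y x" by (simp add: s B.meet_comm[OF ab'])
    show "join A x y = join A y x" by (simp add: s B.join_comm[OF ab'])
    show "meet A x (join A x y) = x" by (simp add: s B.meet_absorb[OF ab'])
    show "join A x (meet A x y) = x" by (simp add: s B.join_absorb[OF ab'])
    show "dneg A (meet A x y) = join A (dneg A x) (dneg A y)"
      by (simp add: s B.dneg_meet[OF ab'])
    show "perf A (meet A x y) = meet A (meet A (join A (perf A x) (perf A y))
        (join A (perf A x) (dneg A y))) (join A (perf A y) (dneg A x))"
      by (simp add: s B.perf_meet[OF ab'])
  next
    fix x assume x: "x \<in> carrier A"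
    then obtain a where a: "a \<in> C" and xa: "x = f a"
      by (auto simp: A_def)
    note a' = a[THEN CB]
    note s = A_def xa gf a C
    show "meet A x (one A) = x" by (simp add: s B.meet_one[OF a'])
    show "join A x (zero A) = x" by (simp add: s B.join_zero[OF a'])
    show "dneg A x \<in> carrier A" "perf A x \<in> carrier A" by (simp_all add: s)
    show "dneg A (dneg A x) = x" by (simp add: s B.dneg_dneg[OF a'])
    show "perf A (perf A x) = one A" by (simp add: s B.perf_perf[OF a'])
    show "perf A x = perf A (dneg A x)" by (simp add: s B.perf_dneg[OF a', symmetric])
    show "meet A (meet A x (dneg A x)) (perf A x) = zero A"
      by (simp add: s B.perf_explosion[OF a'])
  next
    show "one A \<in> carrier A" "zero A \<in> carrier A" by (simp_all add: A_def C)
    show "perf A (one A) = one A" by (simp add: A_def gf C B.perf_one)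
  qed
  have vC: "v n \<in> C" for n unfolding C_def by (metis eval.simps(1) rangeI)
  have ev: "eval A (f \<circ> v) \<phi> = f (eval B v \<phi>)" for \<phi>
  proof -
    have "eval B v \<psi> \<in> C" for \<psi> by (simp add: C_def)
    then show ?thesis by (induction \<phi>) (simp_all add: A_def gf)
  qed
  have "range (f \<circ> v) \<subseteq> carrier A" using vC by (auto simp: A_def)
  then have "eval A (f \<circ> v) s = eval A (f \<circ> v) t"
    using valid \<open>PP_algebra A\<close> by (auto simp: pp_valid_def)
  then have "f (eval B v s) = f (eval B v t)" by (simp add: ev)
  then show ?thesis using f by (auto simp: C_def dest: inj_onD)
qed


section \<open>Set-Set logics\<close>

text \<open>
  Generalized consequence relations: overlap, dilution, cut for sets and substitution-invariance.
\<close>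

definition set_set_logic :: "(fm set \<Rightarrow> fm set \<Rightarrow> bool) \<Rightarrow> bool" where
  "set_set_logic L \<longleftrightarrow>
     (\<forall>\<Phi> \<Psi>. \<Phi> \<inter> \<Psi> \<noteq> {} \<longrightarrow> L \<Phi> \<Psi>) \<and>
     (\<forall>\<Phi> \<Psi> \<Phi>' \<Psi>'. L \<Phi> \<Psi> \<longrightarrow> L (\<Phi> \<union> \<Phi>') (\<Psi> \<union> \<Psi>')) \<and>
     (\<forall>\<Phi> \<Psi>. (\<forall>\<Omega>. L (\<Phi> \<union> \<Omega>) (\<Psi> \<union> - \<Omega>)) \<longrightarrow> L \<Phi> \<Psi>) \<and>
     (\<forall>\<Phi> \<Psi> \<sigma>. L \<Phi> \<Psi> \<longrightarrow> L (subst \<sigma> ` \<Phi>) (subst \<sigma> ` \<Psi>))"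

text \<open>
  The finite subsets of \<open>\<Phi>\<close> and \<open>\<Psi>\<close> are given by enumerations; the order and multiplicity of
  the entries do not affect the validity of the equation.
\<close>

definition PP_le :: "'a::infinite itself \<Rightarrow> fm set \<Rightarrow> fm set \<Rightarrow> bool" where
  "PP_le T \<Phi> \<Psi> \<longleftrightarrow>
     (\<exists>\<phi>s \<psi>s. set \<phi>s \<subseteq> \<Phi> \<and> set \<psi>s \<subseteq> \<Psi> \<and>
        pp_valid T (big_conj \<phi>s) (Conj (big_conj \<phi>s) (big_disj \<psi>s)))"

definition paraconsistent :: "(fm set \<Rightarrow> fm set \<Rightarrow> bool) \<Rightarrow> bool" where
  "paraconsistent L \<longleftrightarrow> (\<forall>p q. p \<noteq> q \<longrightarrow> \<not> L {Var p, Neg (Var p)} {Var q})"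

definition paracomplete :: "(fm set \<Rightarrow> fm set \<Rightarrow> bool) \<Rightarrow> bool" where
  "paracomplete L \<longleftrightarrow> (\<forall>p q. p \<noteq> q \<longrightarrow> \<not> L {Var q} {Var p, Neg (Var p)})"

text \<open>\<open>inst p S \<phi>\<close> is \<open>S(\<phi>)\<close>, for a set \<open>S = S(p)\<close> of formulas in the variable \<open>p\<close>.\<close>

definition inst :: "nat \<Rightarrow> fm set \<Rightarrow> fm \<Rightarrow> fm set" where
  "inst p S \<phi> = subst (Var(p := \<phi>)) ` S"

definition gently_explosive_with ::
    "(fm set \<Rightarrow> fm set \<Rightarrow> bool) \<Rightarrow> nat \<Rightarrow> fm set \<Rightarrow> bool" where
  "gently_explosive_with L p S \<longleftrightarrow>
     (\<forall>\<chi>\<in>S. vars \<chi> \<subseteq> {p}) \<and>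
     (\<exists>\<phi>. \<not> L (inst p S \<phi> \<union> {\<phi>}) {} \<and> \<not> L (inst p S \<phi> \<union> {Neg \<phi>}) {}) \<and>
     (\<forall>\<psi>. L (inst p S \<psi> \<union> {\<psi>, Neg \<psi>}) {})"

definition gently_explosive :: "(fm set \<Rightarrow> fm set \<Rightarrow> bool) \<Rightarrow> bool" where
  "gently_explosive L \<longleftrightarrow> (\<exists>p S. gently_explosive_with L p S)"

definition gently_implosive_with ::
    "(fm set \<Rightarrow> fm set \<Rightarrow> bool) \<Rightarrow> nat \<Rightarrow> fm set \<Rightarrow> bool" where
  "gently_implosive_with L p S \<longleftrightarrow>
     (\<forall>\<chi>\<in>S. vars \<chi> \<subseteq> {p}) \<and>
     (\<exists>\<phi>. \<not> L {} ({\<phi>} \<union> inst p S \<phi>) \<and> \<not> L {} ({Neg \<phi>} \<union> inst p S \<phi>)) \<and>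
     (\<forall>\<psi>. L {} ({Neg \<psi>, \<psi>} \<union> inst p S \<psi>))"

definition gently_implosive :: "(fm set \<Rightarrow> fm set \<Rightarrow> bool) \<Rightarrow> bool" where
  "gently_implosive L \<longleftrightarrow> (\<exists>p S. gently_implosive_with L p S)"

definition LFI :: "(fm set \<Rightarrow> fm set \<Rightarrow> bool) \<Rightarrow> bool" where
  "LFI L \<longleftrightarrow> set_set_logic L \<and> paraconsistent L \<and> gently_explosive L"

definition LFU :: "(fm set \<Rightarrow> fm set \<Rightarrow> bool) \<Rightarrow> bool" where
  "LFU L \<longleftrightarrow> set_set_logic L \<and> paracomplete L \<and> gently_implosive L"

definition agree_neg_free ::
    "(fm set \<Rightarrow> fm set \<Rightarrow> bool) \<Rightarrow> (fm set \<Rightarrow> fm set \<Rightarrow> bool) \<Rightarrow> bool" where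
  "agree_neg_free L1 L2 \<longleftrightarrow>
     (\<forall>\<Phi> \<Psi>. (\<forall>\<phi>\<in>\<Phi> \<union> \<Psi>. neg_free \<phi>) \<longrightarrow> (L1 \<Phi> \<Psi> \<longleftrightarrow> L2 \<Phi> \<Psi>))"

text \<open>
  A possibly composite unary connective is represented by the formula \<open>c\<close> that results from
  applying it to the variable \<open>p\<close>.
\<close>

definition C_system_based_on ::
    "(fm set \<Rightarrow> fm set \<Rightarrow> bool) \<Rightarrow> (fm set \<Rightarrow> fm set \<Rightarrow> bool) \<Rightarrow> nat \<Rightarrow> fm \<Rightarrow> bool" where
  "C_system_based_on L1 L2 p c \<longleftrightarrow>
     LFI L1 \<and> set_set_logic L2 \<and> agree_neg_free L1 L2 \<and> gently_explosive_with L1 p {c}"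

definition C_system :: "(fm set \<Rightarrow> fm set \<Rightarrow> bool) \<Rightarrow> nat \<Rightarrow> fm \<Rightarrow> bool" where
  "C_system L p c \<longleftrightarrow> (\<exists>L2. C_system_based_on L L2 p c)"

definition D_system_based_on ::
    "(fm set \<Rightarrow> fm set \<Rightarrow> bool) \<Rightarrow> (fm set \<Rightarrow> fm set \<Rightarrow> bool) \<Rightarrow> nat \<Rightarrow> fm \<Rightarrow> bool" where
  "D_system_based_on L1 L2 p c \<longleftrightarrow>
     LFU L1 \<and> set_set_logic L2 \<and> agree_neg_free L1 L2 \<and> gently_implosive_with L1 p {c}"

definition D_system :: "(fm set \<Rightarrow> fm set \<Rightarrow> bool) \<Rightarrow> nat \<Rightarrow> fm \<Rightarrow> bool" where
  "D_system L p c \<longleftrightarrow> (\<exists>L2. D_system_based_on L L2 p c)"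

end

theory Submission
  imports Defs
begin

text \<open>
  A logic agrees with itself on \<open>\<sim>\<close>-free statements, so it may serve as its own base logic. What
  has to be shown is that the order-preserving logic is a generalized consequence relation, that it
  is paraconsistent and paracomplete, and that \<open>\<circ>p\<close> and \<open>\<sim>\<circ>p\<close> witness gentle explosion and
  gentle implosion.

  The valid halves of gentle explosion and implosion are the axiom
  \<open>x \<sqinter> \<sim>x \<sqinter> \<circ>x = \<bottom>\<close> and its De Morgan dual \<open>\<sim>x \<squnion> x \<squnion> \<sim>\<circ>x = \<top>\<close>. All underivability claims
  are witnessed by one algebra, the chain \<open>0 < 1 < 2\<close> in which \<open>\<circ>\<close> sends the middle element to the
  bottom and the two others to the top (\<open>PP_algebra_three_chain\<close>). In an order-preserving logic a
  statement fails as soon as the meet of the premises is not below the join of the conclusions, so the middle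
  element \<open>m = \<sim>m\<close> refutes both \<open>p, \<sim>p \<rhd> q\<close> (as \<open>m\<close> is not below \<open>0\<close>) and
  \<open>q \<rhd> p, \<sim>p\<close> (as \<open>2\<close> is not below \<open>m\<close>).

  The most substantial structural condition is cut for sets. For a finitary relation it follows from
  cut for single formulas by extending the premises to a maximal set that does not entail the
  conclusions (\<open>cut_for_sets_if_finitary\<close>). Cut for single formulas is the lattice-theoretic fact
  that \<open>x \<sqinter> c \<le> y\<close> and \<open>x \<le> y \<squnion> c\<close> imply \<open>x \<le> y\<close>, which is distributivity
  (\<open>le_cut\<close>).
\<close>

section \<open>Cut for sets in finitary relations\<close>

text \<open>
  A maximal \<open>\<Omega> \<supseteq> \<Phi>\<close> with \<open>\<Omega> \<rhd> \<Psi>\<close> failing exists because, by finitarity, failure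
  survives unions of chains. Each formula outside \<open>\<Omega>\<close> yields \<open>\<Psi>\<close> once it is added to \<open>\<Omega>\<close>, so
  finitely many such formulas can be cut one after the other from the right of
  \<open>\<Omega> \<rhd> \<Psi> \<union> - \<Omega>\<close>, which leaves \<open>\<Omega> \<rhd> \<Psi>\<close>.
\<close>

lemma cut_for_sets_if_finitary:
  fixes L :: "'f set \<Rightarrow> 'f set \<Rightarrow> bool"
  assumes mono: "\<And>\<Phi> \<Psi> \<Phi>' \<Psi>'. \<lbrakk>L \<Phi> \<Psi>; \<Phi> \<subseteq> \<Phi>'; \<Psi> \<subseteq> \<Psi>'\<rbrakk> \<Longrightarrow> L \<Phi>' \<Psi>'"
    and finitary: "\<And>\<Phi> \<Psi>. L \<Phi> \<Psi> \<Longrightarrow> \<exists>F G. finite F \<and> finite G \<and> F \<subseteq> \<Phi> \<and> G \<subseteq> \<Psi> \<and> L F G"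
    and cut: "\<And>\<Phi> \<Psi> \<chi>. \<lbrakk>L (insert \<chi> \<Phi>) \<Psi>; L \<Phi> (insert \<chi> \<Psi>)\<rbrakk> \<Longrightarrow> L \<Phi> \<Psi>"
    and all: "\<And>\<Omega>. L (\<Phi> \<union> \<Omega>) (\<Psi> \<union> - \<Omega>)"
  shows "L \<Phi> \<Psi>"
proof (rule ccontr)
  assume not: "\<not> L \<Phi> \<Psi>"
  define X where "X = {\<Gamma>. \<Phi> \<subseteq> \<Gamma> \<and> \<not> L \<Gamma> \<Psi>}"
  have "\<exists>\<Omega>\<in>X. \<forall>\<Gamma>\<in>X. \<Omega> \<subseteq> \<Gamma> \<longrightarrow> \<Gamma> = \<Omega>"
  proof (rule subset_Zorn_nonempty)
    show "X \<noteq> {}" using not by (auto simp: X_def)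
  next
    fix \<C> assume ne: "\<C> \<noteq> {}" and chain: "subset.chain X \<C>"
    have CX: "\<C> \<subseteq> X" using chain by (simp add: subset_chain_def)
    have "\<not> L (\<Union>\<C>) \<Psi>"
    proof
      assume "L (\<Union>\<C>) \<Psi>"
      then obtain F G where F: "finite F" "F \<subseteq> \<Union>\<C>" and G: "G \<subseteq> \<Psi>" and FG: "L F G"
        using finitary[of "\<Union>\<C>" \<Psi>] by blast
      obtain \<Gamma> where "\<Gamma> \<in> \<C>" "F \<subseteq> \<Gamma>"
        using finite_subset_Union_chain[OF F ne chain] by blast
      then have "L \<Gamma> \<Psi>" using mono[OF FG _ G] by simp
      with \<open>\<Gamma> \<in> \<C>\<close> CX show False by (auto simp: X_def)
    qed
    moreover have "\<Phi> \<subseteq> \<Union>\<C>" using ne CX by (auto simp: X_def)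
    ultimately show "\<Union>\<C> \<in> X" by (simp add: X_def)
  qed
  then obtain \<Omega> where "\<Omega> \<in> X" and max: "\<And>\<Gamma>. \<lbrakk>\<Gamma> \<in> X; \<Omega> \<subseteq> \<Gamma>\<rbrakk> \<Longrightarrow> \<Gamma> = \<Omega>" by blast
  then have \<Phi>: "\<Phi> \<subseteq> \<Omega>" and \<Psi>: "\<not> L \<Omega> \<Psi>" by (auto simp: X_def)
  have outside: "L (insert \<chi> \<Omega>) \<Psi>" if "\<chi> \<notin> \<Omega>" for \<chi>
    using max[of "insert \<chi> \<Omega>"] that \<Phi> by (auto simp: X_def)
  have cut_all: "L \<Omega> \<Psi>" if "finite D" "D \<inter> \<Omega> = {}" "L \<Omega> (\<Psi> \<union> D)" for D
    using that
  proof (induction D rule: finite_induct)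
    case (insert \<chi> D)
    have "L (insert \<chi> \<Omega>) (\<Psi> \<union> D)" using insert.prems outside by (intro mono[OF outside]) auto
    moreover have "L \<Omega> (insert \<chi> (\<Psi> \<union> D))" using insert.prems by simp
    ultimately have "L \<Omega> (\<Psi> \<union> D)" by (rule cut)
    then show ?case using insert by auto
  qed simp
  have "L \<Omega> (\<Psi> \<union> - \<Omega>)" using all[of \<Omega>] \<Phi> by (simp add: Un_absorb1)
  then obtain F G where "finite G" "F \<subseteq> \<Omega>" "G \<subseteq> \<Psi> \<union> - \<Omega>" "L F G"
    using finitary[of \<Omega> "\<Psi> \<union> - \<Omega>"] by blast
  then have "L \<Omega> (\<Psi> \<union> (G - \<Omega>))" using mono[of F G \<Omega> "\<Psi> \<union> (G - \<Omega>)"] by blast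
  then show False using cut_all[of "G - \<Omega>"] \<open>finite G\<close> \<Psi> by auto
qed


section \<open>The lattice order\<close>

definition le_on :: "'a pp_struct \<Rightarrow> 'a \<Rightarrow> 'a \<Rightarrow> bool" where
  "le_on A x y \<longleftrightarrow> meet A x y = x"

lemma (in bounded_distributive_lattice) le_refl:
  assumes "x \<in> carrier A" shows "le_on A x x"
  using assms join_absorb meet_absorb meet_closed unfolding le_on_def by metis

lemma (in bounded_distributive_lattice) le_trans:
  assumes "x \<in> carrier A" "y \<in> carrier A" "z \<in> carrier A" "le_on A x y" "le_on A y z"
  shows "le_on A x z"
  using assms meet_assoc unfolding le_on_def by metis

lemma (in bounded_distributive_lattice) le_iff_join:
  assumes "x \<in> carrier A" "y \<in> carrier A"
  shows "le_on A x y \<longleftrightarrow> x \<squnion> y = y"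
  using assms join_absorb meet_absorb meet_comm join_comm unfolding le_on_def by metis

lemma (in bounded_distributive_lattice) one_greatest:
  "x \<in> carrier A \<Longrightarrow> le_on A x \<top>"
  by (simp add: le_on_def meet_one)

lemma (in bounded_distributive_lattice) zero_least:
  "x \<in> carrier A \<Longrightarrow> le_on A \<bottom> x"
  by (simp add: le_iff_join zero_closed join_comm[OF zero_closed] join_zero)

lemma (in bounded_distributive_lattice) le_meet_iff:
  assumes "x \<in> carrier A" "y \<in> carrier A" "z \<in> carrier A"
  shows "le_on A z (x \<sqinter> y) \<longleftrightarrow> le_on A z x \<and> le_on A z y"
proof -
  have "le_on A (x \<sqinter> y) x" "le_on A (x \<sqinter> y) y"
    using assms meet_assoc meet_comm le_refl meet_closed unfolding le_on_def by metis+
  moreover have "le_on A z (x \<sqinter> y)" if "le_on A z x" "le_on A z y"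
    using that assms meet_assoc[of z x y] by (simp add: le_on_def)
  ultimately show ?thesis using assms le_trans meet_closed by blast
qed

lemma (in bounded_distributive_lattice) join_le_iff:
  assumes "x \<in> carrier A" "y \<in> carrier A" "z \<in> carrier A"
  shows "le_on A (x \<squnion> y) z \<longleftrightarrow> le_on A x z \<and> le_on A y z"
proof -
  have "le_on A x (x \<squnion> y)" "le_on A y (x \<squnion> y)"
    using assms meet_absorb join_comm unfolding le_on_def by metis+
  moreover have "le_on A (x \<squnion> y) z" if "le_on A x z" "le_on A y z"
    using that assms by (simp add: le_iff_join join_closed join_assoc)
  ultimately show ?thesis using assms le_trans join_closed by blast
qed

lemma (in bounded_distributive_lattice) le_cut:
  assumes xyc: "x \<in> carrier A" "y \<in> carrier A" "c \<in> carrier A"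
    and "le_on A (x \<sqinter> c) y" and "le_on A x (y \<squnion> c)"
  shows "le_on A x y"
proof -
  have "x = (x \<sqinter> y) \<squnion> (x \<sqinter> c)" using assms by (simp add: le_on_def distrib)
  moreover have "le_on A (x \<sqinter> y) y"
    using le_meet_iff[of x y "x \<sqinter> y"] le_refl[of "x \<sqinter> y"] xyc by (simp add: meet_closed)
  ultimately show ?thesis
    using assms join_le_iff[of "x \<sqinter> y" "x \<sqinter> c" y] by (simp add: meet_closed)
qed


section \<open>Entailment in an algebra\<close>

text \<open>
  For finite sets this says that the meet of the values of \<open>\<Phi>\<close> lies below the join of the values
  of \<open>\<Psi>\<close>. Speaking of arbitrary lower and upper bounds instead frees the condition from any
  enumeration of the sets, extends it to infinite ones and makes it visibly monotone in both.
\<close>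

definition entails :: "'a pp_struct \<Rightarrow> (nat \<Rightarrow> 'a) \<Rightarrow> fm set \<Rightarrow> fm set \<Rightarrow> bool" where
  "entails A v \<Phi> \<Psi> \<longleftrightarrow> (\<forall>x\<in>carrier A. \<forall>y\<in>carrier A.
     (\<forall>\<phi>\<in>\<Phi>. le_on A x (eval A v \<phi>)) \<longrightarrow> (\<forall>\<psi>\<in>\<Psi>. le_on A (eval A v \<psi>) y) \<longrightarrow> le_on A x y)"

lemma entailsD:
  "\<lbrakk>entails A v \<Phi> \<Psi>; x \<in> carrier A; y \<in> carrier A; \<forall>\<phi>\<in>\<Phi>. le_on A x (eval A v \<phi>);
    \<forall>\<psi>\<in>\<Psi>. le_on A (eval A v \<psi>) y\<rbrakk> \<Longrightarrow> le_on A x y"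
  by (simp add: entails_def)

lemma entails_mono:
  "\<lbrakk>entails A v \<Phi> \<Psi>; \<Phi> \<subseteq> \<Phi>'; \<Psi> \<subseteq> \<Psi>'\<rbrakk> \<Longrightarrow> entails A v \<Phi>' \<Psi>'"
  unfolding entails_def by blast

lemma eval_subst: "eval A v (subst \<sigma> \<phi>) = eval A (\<lambda>n. eval A v (\<sigma> n)) \<phi>"
  by (induction \<phi>) auto

lemma entails_subst:
  "entails A v (subst \<sigma> ` \<Phi>) (subst \<sigma> ` \<Psi>) \<longleftrightarrow> entails A (\<lambda>n. eval A v (\<sigma> n)) \<Phi> \<Psi>"
  by (simp add: entails_def eval_subst)

lemma (in PP_algebra) le_big_conj_iff:
  assumes "range v \<subseteq> carrier A" "x \<in> carrier A"
  shows "le_on A x (eval A v (big_conj \<phi>s)) \<longleftrightarrow> (\<forall>\<phi>\<in>set \<phi>s. le_on A x (eval A v \<phi>))"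
  by (induction \<phi>s) (auto simp: big_conj_def one_greatest le_meet_iff eval_closed assms)

lemma (in PP_algebra) big_disj_le_iff:
  assumes "range v \<subseteq> carrier A" "y \<in> carrier A"
  shows "le_on A (eval A v (big_disj \<psi>s)) y \<longleftrightarrow> (\<forall>\<psi>\<in>set \<psi>s. le_on A (eval A v \<psi>) y)"
  by (induction \<psi>s) (auto simp: big_disj_def zero_least join_le_iff eval_closed assms)

lemma (in PP_algebra) entails_iff_equation:
  assumes v: "range v \<subseteq> carrier A"
  shows "entails A v (set \<phi>s) (set \<psi>s) \<longleftrightarrow>
    eval A v (big_conj \<phi>s) = eval A v (Conj (big_conj \<phi>s) (big_disj \<psi>s))"
proof -
  define a where "a = eval A v (big_conj \<phi>s)"
  define b where "b = eval A v (big_disj \<psi>s)"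
  have ab: "a \<in> carrier A" "b \<in> carrier A" by (simp_all add: a_def b_def eval_closed v)
  have "entails A v (set \<phi>s) (set \<psi>s) \<longleftrightarrow>
      (\<forall>x\<in>carrier A. \<forall>y\<in>carrier A. le_on A x a \<longrightarrow> le_on A b y \<longrightarrow> le_on A x y)"
    by (simp add: entails_def a_def b_def le_big_conj_iff[OF v] big_disj_le_iff[OF v])
  also have "\<dots> \<longleftrightarrow> le_on A a b" using ab le_refl le_trans by meson
  finally show ?thesis by (auto simp: le_on_def a_def b_def)
qed

lemma (in PP_algebra) entails_cut:
  assumes v: "range v \<subseteq> carrier A"
    and left: "entails A v (insert \<chi> \<Phi>) \<Psi>" and right: "entails A v \<Phi> (insert \<chi> \<Psi>)"
  shows "entails A v \<Phi> \<Psi>"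
  unfolding entails_def
proof (intro ballI impI)
  fix x y assume x: "x \<in> carrier A" and y: "y \<in> carrier A"
    and lower: "\<forall>\<phi>\<in>\<Phi>. le_on A x (eval A v \<phi>)" and upper: "\<forall>\<psi>\<in>\<Psi>. le_on A (eval A v \<psi>) y"
  define c where "c = eval A v \<chi>"
  have c: "c \<in> carrier A" by (simp add: c_def eval_closed v)
  have meet: "le_on A (x \<sqinter> c) x" "le_on A (x \<sqinter> c) c"
    using le_meet_iff[of x c "x \<sqinter> c"] le_refl[of "x \<sqinter> c"] x c by (simp_all add: meet_closed)
  have join: "le_on A y (y \<squnion> c)" "le_on A c (y \<squnion> c)"
    using join_le_iff[of y c "y \<squnion> c"] le_refl[of "y \<squnion> c"] y c by (simp_all add: join_closed)
  have "\<forall>\<phi>\<in>insert \<chi> \<Phi>. le_on A (x \<sqinter> c) (eval A v \<phi>)"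
    using lower meet le_trans[OF meet_closed[OF x c] x eval_closed[OF v]] by (simp add: c_def)
  then have "le_on A (x \<sqinter> c) y"
    using entailsD[OF left meet_closed[OF x c] y] upper by blast
  moreover have "\<forall>\<psi>\<in>insert \<chi> \<Psi>. le_on A (eval A v \<psi>) (y \<squnion> c)"
    using upper join le_trans[OF eval_closed[OF v] y join_closed[OF y c]] by (simp add: c_def)
  then have "le_on A x (y \<squnion> c)"
    using entailsD[OF right x join_closed[OF y c]] lower by blast
  ultimately show "le_on A x y" using le_cut x y c by blast
qed


section \<open>The order-preserving logic as a generalized consequence relation\<close>

lemma PP_le_iff_entails:
  "PP_le TYPE('a::infinite) \<Phi> \<Psi> \<longleftrightarrow>
    (\<exists>F G. finite F \<and> finite G \<and> F \<subseteq> \<Phi> \<and> G \<subseteq> \<Psi> \<and>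
      (\<forall>(A :: 'a pp_struct) v. PP_algebra A \<longrightarrow> range v \<subseteq> carrier A \<longrightarrow> entails A v F G))"
    (is "?L \<longleftrightarrow> ?R")
proof -
  have eq: "pp_valid TYPE('a) (big_conj \<phi>s) (Conj (big_conj \<phi>s) (big_disj \<psi>s)) \<longleftrightarrow>
      (\<forall>(A :: 'a pp_struct) v. PP_algebra A \<longrightarrow> range v \<subseteq> carrier A \<longrightarrow>
        entails A v (set \<phi>s) (set \<psi>s))" for \<phi>s \<psi>s
    unfolding pp_valid_def by (meson PP_algebra.entails_iff_equation)
  show ?thesis
  proof
    assume ?L
    then show ?R unfolding PP_le_def eq by (meson List.finite_set)
  next
    assume ?R
    then show ?L unfolding PP_le_def eq by (metis finite_list)
  qed
qed

lemma PP_leI: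
  assumes "finite \<Phi>" "finite \<Psi>"
    and "\<And>(A :: 'a pp_struct) v. \<lbrakk>PP_algebra A; range v \<subseteq> carrier A\<rbrakk> \<Longrightarrow> entails A v \<Phi> \<Psi>"
  shows "PP_le TYPE('a::infinite) \<Phi> \<Psi>"
  using assms unfolding PP_le_iff_entails by blast

text \<open>
  Since validity does not depend on the choice of the infinite type, refutations may use an algebra
  on any convenient type.
\<close>

lemma PP_le_sound:
  fixes B :: "'b pp_struct"
  assumes "PP_le TYPE('a::infinite) \<Phi> \<Psi>" "PP_algebra B" "range v \<subseteq> carrier B"
  shows "entails B v \<Phi> \<Psi>"
proof -
  obtain \<phi>s \<psi>s where "set \<phi>s \<subseteq> \<Phi>" "set \<psi>s \<subseteq> \<Psi>"
    and valid: "pp_valid TYPE('a) (big_conj \<phi>s) (Conj (big_conj \<phi>s) (big_disj \<psi>s))"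
    using assms(1) by (auto simp: PP_le_def)
  moreover have "entails B v (set \<phi>s) (set \<psi>s)"
    using pp_valid_universal[OF valid assms(2,3)] PP_algebra.entails_iff_equation[OF assms(2,3)]
    by blast
  ultimately show ?thesis using entails_mono by metis
qed

lemma PP_le_mono:
  "\<lbrakk>PP_le TYPE('a::infinite) \<Phi> \<Psi>; \<Phi> \<subseteq> \<Phi>'; \<Psi> \<subseteq> \<Psi>'\<rbrakk> \<Longrightarrow> PP_le TYPE('a) \<Phi>' \<Psi>'"
  unfolding PP_le_def by (meson subset_trans)

lemma PP_le_finitary:
  assumes "PP_le TYPE('a::infinite) \<Phi> \<Psi>"
  shows "\<exists>F G. finite F \<and> finite G \<and> F \<subseteq> \<Phi> \<and> G \<subseteq> \<Psi> \<and> PP_le TYPE('a) F G"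
  using assms unfolding PP_le_def by (metis List.finite_set subset_refl)

text \<open>
  The two given statements have finite parts of their own; weakening both to the common finite sets
  \<open>F\<close> and \<open>G\<close> brings them into the form needed for cutting inside each algebra.
\<close>

lemma PP_le_cut:
  assumes left: "PP_le TYPE('a::infinite) (insert \<chi> \<Phi>) \<Psi>"
    and right: "PP_le TYPE('a) \<Phi> (insert \<chi> \<Psi>)"
  shows "PP_le TYPE('a) \<Phi> \<Psi>"
proof -
  obtain F1 G1 where 1: "finite F1" "finite G1" "F1 \<subseteq> insert \<chi> \<Phi>" "G1 \<subseteq> \<Psi>" "PP_le TYPE('a) F1 G1"
    using PP_le_finitary[OF left] by blast
  obtain F2 G2 where 2: "finite F2" "finite G2" "F2 \<subseteq> \<Phi>" "G2 \<subseteq> insert \<chi> \<Psi>" "PP_le TYPE('a) F2 G2"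
    using PP_le_finitary[OF right] by blast
  define F where "F = (F1 - {\<chi>}) \<union> F2"
  define G where "G = G1 \<union> (G2 - {\<chi>})"
  have FG: "PP_le TYPE('a) (insert \<chi> F) G" "PP_le TYPE('a) F (insert \<chi> G)"
    by (rule PP_le_mono[OF 1(5)] PP_le_mono[OF 2(5)]; auto simp: F_def G_def)+
  have "PP_le TYPE('a) F G"
  proof (rule PP_leI)
    show "finite F" "finite G" using 1 2 by (simp_all add: F_def G_def)
  next
    fix A :: "'a pp_struct" and v :: "nat \<Rightarrow> 'a"
    assume "PP_algebra A" "range v \<subseteq> carrier A"
    then show "entails A v F G" using FG by (meson PP_algebra.entails_cut PP_le_sound)
  qed
  moreover have "F \<subseteq> \<Phi>" "G \<subseteq> \<Psi>" using 1 2 by (auto simp: F_def G_def)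
  ultimately show ?thesis by (rule PP_le_mono)
qed

lemma PP_le_subst:
  assumes "PP_le TYPE('a::infinite) \<Phi> \<Psi>"
  shows "PP_le TYPE('a) (subst \<sigma> ` \<Phi>) (subst \<sigma> ` \<Psi>)"
proof -
  obtain F G where FG: "finite F" "finite G" "F \<subseteq> \<Phi>" "G \<subseteq> \<Psi>" "PP_le TYPE('a) F G"
    using PP_le_finitary[OF assms] by blast
  have "PP_le TYPE('a) (subst \<sigma> ` F) (subst \<sigma> ` G)"
  proof (rule PP_leI)
    fix A :: "'a pp_struct" and v :: "nat \<Rightarrow> 'a"
    assume A: "PP_algebra A" and v: "range v \<subseteq> carrier A"
    have "range (\<lambda>n. eval A v (\<sigma> n)) \<subseteq> carrier A" using PP_algebra.eval_closed[OF A v] by auto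
    then show "entails A v (subst \<sigma> ` F) (subst \<sigma> ` G)"
      unfolding entails_subst using FG(5) A by (simp add: PP_le_sound)
  qed (use FG in auto)
  then show ?thesis by (rule PP_le_mono) (use FG in auto)
qed

lemma set_set_logic_PP_le: "set_set_logic (PP_le TYPE('a::infinite))"
  unfolding set_set_logic_def
proof (intro conjI allI impI)
  fix \<Phi> \<Psi> :: "fm set" assume "\<Phi> \<inter> \<Psi> \<noteq> {}"
  then obtain \<chi> where \<chi>: "\<chi> \<in> \<Phi>" "\<chi> \<in> \<Psi>" by blast
  have "PP_le TYPE('a) {\<chi>} {\<chi>}"
  proof (rule PP_leI)
    fix A :: "'a pp_struct" and v :: "nat \<Rightarrow> 'a"
    assume A: "PP_algebra A" and v: "range v \<subseteq> carrier A"
    interpret PP_algebra A by (rule A)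
    show "entails A v {\<chi>} {\<chi>}"
      unfolding entails_def using le_trans[OF _ eval_closed[OF v]] by blast
  qed simp_all
  then show "PP_le TYPE('a) \<Phi> \<Psi>" by (rule PP_le_mono) (use \<chi> in auto)
next
  fix \<Phi> \<Psi> \<Phi>' \<Psi>' :: "fm set" assume "PP_le TYPE('a) \<Phi> \<Psi>"
  then show "PP_le TYPE('a) (\<Phi> \<union> \<Phi>') (\<Psi> \<union> \<Psi>')" by (rule PP_le_mono) auto
next
  fix \<Phi> \<Psi> :: "fm set" assume all: "\<forall>\<Omega>. PP_le TYPE('a) (\<Phi> \<union> \<Omega>) (\<Psi> \<union> - \<Omega>)"
  show "PP_le TYPE('a) \<Phi> \<Psi>"
  proof (rule cut_for_sets_if_finitary[where L = "PP_le TYPE('a)"])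
    show "PP_le TYPE('a) (\<Phi> \<union> \<Omega>) (\<Psi> \<union> - \<Omega>)" for \<Omega> using all by blast
  qed (erule (2) PP_le_mono, erule PP_le_finitary, erule (1) PP_le_cut)
next
  fix \<Phi> \<Psi> \<sigma> assume "PP_le TYPE('a) \<Phi> \<Psi>"
  then show "PP_le TYPE('a) (subst \<sigma> ` \<Phi>) (subst \<sigma> ` \<Psi>)" by (rule PP_le_subst)
qed


section \<open>Refutations in the three-element chain\<close>

definition three_chain :: "int pp_struct" where
  "three_chain = \<lparr>carrier = {0, 1, 2}, meet = min, join = max, dneg = (\<lambda>x. 2 - x),
     perf = (\<lambda>x. if x = 1 then 0 else 2), one = 2, zero = 0\<rparr>"

lemma PP_algebra_three_chain: "PP_algebra three_chain"
  by unfold_locales (auto simp: three_chain_def min_def max_def)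

lemma le_on_three_chain: "le_on three_chain x y \<longleftrightarrow> x \<le> y"
  by (auto simp: le_on_def three_chain_def)

lemma not_PP_le_if_separated:
  assumes "range v \<subseteq> {0, 1, 2}" "x \<in> {0, 1, 2}" "y \<in> {0, 1, 2}" "y < x"
    and "\<forall>\<phi>\<in>\<Phi>. x \<le> eval three_chain v \<phi>" "\<forall>\<psi>\<in>\<Psi>. eval three_chain v \<psi> \<le> y"
  shows "\<not> PP_le TYPE('a::infinite) \<Phi> \<Psi>"
proof
  have carrier: "carrier three_chain = {0, 1, 2}" by (simp add: three_chain_def)
  assume "PP_le TYPE('a) \<Phi> \<Psi>"
  then have "entails three_chain v \<Phi> \<Psi>"
    by (rule PP_le_sound[OF _ PP_algebra_three_chain]) (simp add: carrier assms)
  then show False using assms unfolding entails_def le_on_three_chain carrier by fastforce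
qed

lemma paraconsistent_PP_le: "paraconsistent (PP_le TYPE('a::infinite))"
  unfolding paraconsistent_def
proof (intro allI impI)
  fix p q :: nat assume "p \<noteq> q"
  then show "\<not> PP_le TYPE('a) {Var p, Neg (Var p)} {Var q}"
    by (intro not_PP_le_if_separated[where v = "(\<lambda>_. 0)(p := 1)" and x = 1 and y = 0])
      (auto simp: three_chain_def)
qed

lemma paracomplete_PP_le: "paracomplete (PP_le TYPE('a::infinite))"
  unfolding paracomplete_def
proof (intro allI impI)
  fix p q :: nat assume "p \<noteq> q"
  then show "\<not> PP_le TYPE('a) {Var q} {Var p, Neg (Var p)}"
    by (intro not_PP_le_if_separated[where v = "(\<lambda>_. 2)(p := 1)" and x = 2 and y = 1])
      (auto simp: three_chain_def)
qed


section \<open>Gentle explosion and gentle implosion\<close>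

lemma (in de_morgan_algebra) dneg_zero: "\<sim> \<bottom> = \<top>"
proof -
  have "\<sim> \<bottom> = \<sim> (\<sim> \<top> \<sqinter> \<bottom>)"
    using zero_least[OF dneg_closed[OF one_closed]] meet_comm[OF zero_closed dneg_closed[OF one_closed]]
    by (simp add: le_on_def)
  also have "\<dots> = \<top> \<squnion> \<sim> \<bottom>" by (simp add: dneg_meet dneg_closed dneg_dneg one_closed zero_closed)
  also have "\<dots> = \<top>"
    using one_greatest[OF dneg_closed[OF zero_closed]] join_comm[OF one_closed dneg_closed[OF zero_closed]]
    by (simp add: le_iff_join dneg_closed one_closed zero_closed)
  finally show ?thesis .
qed

lemma (in PP_algebra) perf_implosion:
  assumes "x \<in> carrier A"
  shows "\<sim> x \<squnion> x \<squnion> \<sim> (\<odot> x) = \<top>"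
proof -
  have "\<sim> (x \<sqinter> \<sim> x \<sqinter> \<odot> x) = \<top>" using assms by (simp add: perf_explosion dneg_zero)
  then show ?thesis using assms by (simp add: dneg_meet meet_closed dneg_closed perf_closed dneg_dneg)
qed

lemma (in PP_algebra) entails_explosion:
  assumes v: "range v \<subseteq> carrier A"
  shows "entails A v {Circ \<psi>, \<psi>, Neg \<psi>} {}"
  unfolding entails_def
proof (intro ballI impI)
  fix x y assume x: "x \<in> carrier A" and y: "y \<in> carrier A"
    and lower: "\<forall>\<phi>\<in>{Circ \<psi>, \<psi>, Neg \<psi>}. le_on A x (eval A v \<phi>)"
  define c where "c = eval A v \<psi>"
  have c: "c \<in> carrier A" by (simp add: c_def eval_closed v)
  have "le_on A x (c \<sqinter> \<sim> c \<sqinter> \<odot> c)"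
    using lower c x by (simp add: c_def le_meet_iff meet_closed dneg_closed perf_closed)
  then show "le_on A x y"
    using le_trans[OF x zero_closed y] zero_least[OF y] by (simp add: perf_explosion c)
qed

lemma (in PP_algebra) entails_implosion:
  assumes v: "range v \<subseteq> carrier A"
  shows "entails A v {} {Neg \<psi>, \<psi>, Neg (Circ \<psi>)}"
  unfolding entails_def
proof (intro ballI impI)
  fix x y assume x: "x \<in> carrier A" and y: "y \<in> carrier A"
    and upper: "\<forall>\<phi>\<in>{Neg \<psi>, \<psi>, Neg (Circ \<psi>)}. le_on A (eval A v \<phi>) y"
  define c where "c = eval A v \<psi>"
  have c: "c \<in> carrier A" by (simp add: c_def eval_closed v)
  have "le_on A (\<sim> c \<squnion> c \<squnion> \<sim> (\<odot> c)) y"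
    using upper c y by (simp add: c_def join_le_iff join_closed dneg_closed perf_closed)
  then show "le_on A x y"
    using le_trans[OF x one_closed y] one_greatest[OF x] by (simp add: perf_implosion c)
qed

text \<open>
  A variable already witnesses the two underivability conditions, since \<open>\<circ>\<close> takes the value \<open>2\<close>
  on both classical values \<open>2\<close> and \<open>0\<close>. Dually, \<open>\<sim>\<circ>\<close> takes the value \<open>0\<close> on both.
\<close>

lemma gently_explosive_PP_le:
  "gently_explosive_with (PP_le TYPE('a::infinite)) p {Circ (Var p)}"
proof -
  have "\<not> PP_le TYPE('a) {Circ (Var p), Var p} {}"
    by (intro not_PP_le_if_separated[where v = "\<lambda>_. 2" and x = 2 and y = 0])
      (auto simp: three_chain_def)
  moreover have "\<not> PP_le TYPE('a) {Circ (Var p), Neg (Var p)} {}"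
    by (intro not_PP_le_if_separated[where v = "\<lambda>_. 0" and x = 2 and y = 0])
      (auto simp: three_chain_def)
  moreover have "PP_le TYPE('a) {Circ \<psi>, \<psi>, Neg \<psi>} {}" for \<psi>
    by (rule PP_leI) (simp_all add: PP_algebra.entails_explosion)
  ultimately show ?thesis
    unfolding gently_explosive_with_def inst_def
    by (auto intro!: exI[of _ "Var p"] simp: insert_commute)
qed

lemma gently_implosive_PP_le:
  "gently_implosive_with (PP_le TYPE('a::infinite)) p {Neg (Circ (Var p))}"
proof -
  have "\<not> PP_le TYPE('a) {} {Var p, Neg (Circ (Var p))}"
    by (intro not_PP_le_if_separated[where v = "\<lambda>_. 0" and x = 2 and y = 0])
      (auto simp: three_chain_def)
  moreover have "\<not> PP_le TYPE('a) {} {Neg (Var p), Neg (Circ (Var p))}"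
    by (intro not_PP_le_if_separated[where v = "\<lambda>_. 2" and x = 2 and y = 0])
      (auto simp: three_chain_def)
  moreover have "PP_le TYPE('a) {} {Neg \<psi>, \<psi>, Neg (Circ \<psi>)}" for \<psi>
    by (rule PP_leI) (simp_all add: PP_algebra.entails_implosion)
  ultimately show ?thesis
    unfolding gently_implosive_with_def inst_def
    by (auto intro!: exI[of _ "Var p"] simp: insert_commute)
qed


section \<open>The order-preserving logic as a C-system and a D-system\<close>

theorem corollary3p26:
  fixes p :: nat
  shows "C_system (PP_le TYPE('a::infinite)) p (Circ (Var p)) \<and>
    D_system (PP_le TYPE('a)) p (Neg (Circ (Var p))) \<and>
    LFI (PP_le TYPE('a)) \<and> LFU (PP_le TYPE('a))"
proof -
  have LFI: "LFI (PP_le TYPE('a))"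
    unfolding LFI_def gently_explosive_def
    using set_set_logic_PP_le paraconsistent_PP_le gently_explosive_PP_le by blast
  moreover have LFU: "LFU (PP_le TYPE('a))"
    unfolding LFU_def gently_implosive_def
    using set_set_logic_PP_le paracomplete_PP_le gently_implosive_PP_le by blast
  \<comment> \<open>The logic itself serves as the base logic.\<close>
  moreover have "agree_neg_free (PP_le TYPE('a)) (PP_le TYPE('a))"
    by (simp add: agree_neg_free_def)
  ultimately show ?thesis
    unfolding C_system_def C_system_based_on_def D_system_def D_system_based_on_def
    using set_set_logic_PP_le gently_explosive_PP_le gently_implosive_PP_le by blast
qed

end
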